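(* Let $\ell\ge1$ be an integer, $N=\tfrac12\ell(\ell+1)$, $\tau\in\mathbb C$ with $\mathrm{Im}\,\tau>0$, and let $\eta\in\mathbb C$ be generic (i.e. $m\eta\notin\mathbb Z+\tau\mathbb Z$ for every nonzero integer $m$). For $a=1,2,3,4$ let $\mathcal E_a\subset\mathbb C$ be the set of common roots $E$ of the two polynomial equations $$\sum_{j=0}^{\ell}(-1)^j\,\theta_a((N-j)\eta)\begin{bmatrix}\ell\\ j\end{bmatrix}A^{(\ell)}_j(E)=0,$$ $$\sum_{j=0}^{\ell+1}(-1)^j\,\theta_a((N-j)\eta)\,[j-1]\begin{bmatrix}\ell+1\\ j\end{bmatrix}A^{(\ell)}_{|j-1|}(E)=0 .$$ Then the set of edges of bands $\{\pm E_i\}$ of the difference Lamé operator is the union of $\bigcup_{a=1}^4\mathcal E_a$ and its image under the reflection $E\mapsto -E$.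
   Context: Jacobi theta functions ($\theta_a(x)=\theta_a(x|\tau)$): $\theta_1(x)=-\sum_{k\in\mathbb Z}e^{\pi i\tau(k+\frac12)^2+2\pi i(x+\frac12)(k+\frac12)}$, $\theta_2(x)=\sum_{k\in\mathbb Z}e^{\pi i\tau(k+\frac12)^2+2\pi ix(k+\frac12)}$, $\theta_3(x)=\sum_{k\in\mathbb Z}e^{\pi i\tau k^2+2\pi ixk}$, $\theta_4(x)=\sum_{k\in\mathbb Z}e^{\pi i\tau k^2+2\pi i(x+\frac12)k}$. Elliptic numbers: $[j]=\theta_1(j\eta)/\theta_1(\eta)$ for $j\in\mathbb Z$, $[n]!=\prod_{j=1}^n[j]$ (with $[0]!=1$), $\begin{bmatrix}n\\ m\end{bmatrix}=\dfrac{[n]!}{[m]!\,[n-m]!}$. For $0\le s\le\ell$ the polynomial $A^{(\ell)}_{\ell-s}(E)$, of degree $s$, is $$A^{(\ell)}_{\ell-s}(E)=\begin{bmatrix}\ell\\ s\end{bmatrix}\begin{bmatrix}2\ell\\ s\end{bmatrix}^{-1}\det\left(E\,\delta_{i,j}+\frac{[-i]}{[\ell+1-i]}\,\delta_{i,j-1}+\frac{[2\ell+2-i]}{[\ell+1-i]}\,\delta_{i,j+1}\right)_{1\le i,j\le s},\qquad A^{(\ell)}_\ell=1 .$$ Spectral curve: let $\tilde\Gamma$ be the set of $(\zeta,K,E)$ with $\zeta,E\in\mathbb C$, $K\in\mathbb C\setminus\{0\}$, satisfying $$\sum_{j=0}^{\ell}(-1)^jK^{-j}\theta_1(\zeta-j\eta)\begin{bmatrix}\ell\\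 j\end{bmatrix}A^{(\ell)}_j(E)=0,\qquad \sum_{j=0}^{\ell+1}(-1)^jK^{-j}\theta_1(\zeta-j\eta)[j-1]\begin{bmatrix}\ell+1\\ j\end{bmatrix}A^{(\ell)}_{|j-1|}(E)=0.$$ These equations describe the parameters of the double-Bloch solutions of the difference Lamé equation $\psi(x+\eta)+\frac{\theta_1(x+\ell\eta)\theta_1(x-(\ell+1)\eta)}{\theta_1(x)\theta_1(x-\eta)}\psi(x-\eta)=E\psi(x)$. The set $\tilde\Gamma$ is invariant under $(\zeta,K,E)\mapsto(\zeta+1,K,E)$ and $(\zeta,K,E)\mapsto(\zeta+\tau,Ke^{2\pi i\eta},E)$, and the spectral curve $\Gamma$ is the quotient of $\tilde\Gamma$ by these transformations. It is known that $\Gamma$, completed by two points at infinity that are exchanged by the involution below, is a hyperelliptic curve $w^2=\prod_{i=1}^{2\ell+1}(E^2-E_i^2)$ with hyperelliptic involution $(\zeta,K,E)\mapsto(2N\eta-\zeta,K^{-1},E)$. The edges of bands $\pm E_i$ are the branch points of this two-sheeted covering of the $E$-plane, i.e. the values of the function $E$ at the points of $\Gamma$ fixed by the hyperelliptic involution. *)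

theory Defs
  imports "HOL-Analysis.Infinite_Sum" "Jordan_Normal_Form.Determinant"
begin

section \<open>Jacobi theta functions\<close>

definition theta1 :: "complex \<Rightarrow> complex \<Rightarrow> complex" where
  "theta1 \<tau> x = - (\<Sum>\<^sub>\<infinity>k::int. exp (of_real pi * \<i> * \<tau> * (of_int k + 1/2)^2
                       + 2 * of_real pi * \<i> * (x + 1/2) * (of_int k + 1/2)))"

definition theta2 :: "complex \<Rightarrow> complex \<Rightarrow> complex" where
  "theta2 \<tau> x = (\<Sum>\<^sub>\<infinity>k::int. exp (of_real pi * \<i> * \<tau> * (of_int k + 1/2)^2
                       + 2 * of_real pi * \<i> * x * (of_int k + 1/2)))"

definition theta3 :: "complex \<Rightarrow> complex \<Rightarrow> complex" where
  "theta3 \<tau> x = (\<Sum>\<^sub>\<infinity>k::int. exp (of_real pi * \<i> * \<tau> * of_int k ^ 2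
                       + 2 * of_real pi * \<i> * x * of_int k))"

definition theta4 :: "complex \<Rightarrow> complex \<Rightarrow> complex" where
  "theta4 \<tau> x = (\<Sum>\<^sub>\<infinity>k::int. exp (of_real pi * \<i> * \<tau> * of_int k ^ 2
                       + 2 * of_real pi * \<i> * (x + 1/2) * of_int k))"

text \<open>Only the indices 1, 2, 3, 4 are meaningful.\<close>

definition theta :: "nat \<Rightarrow> complex \<Rightarrow> complex \<Rightarrow> complex" where
  "theta a = (if a = 1 then theta1 else if a = 2 then theta2 else if a = 3 then theta3 else theta4)"

section \<open>Elliptic numbers\<close>

definition ell_num :: "complex \<Rightarrow> complex \<Rightarrow> int \<Rightarrow> complex" where
  "ell_num \<tau> \<eta> j = theta1 \<tau> (of_int j * \<eta>) / theta1 \<tau> \<eta>"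

definition ell_fact :: "complex \<Rightarrow> complex \<Rightarrow> nat \<Rightarrow> complex" where
  "ell_fact \<tau> \<eta> n = (\<Prod>j=1..n. ell_num \<tau> \<eta> (int j))"

text \<open>Meaningful for \<open>m \<le> n\<close>.\<close>

definition ell_binom :: "complex \<Rightarrow> complex \<Rightarrow> nat \<Rightarrow> nat \<Rightarrow> complex" where
  "ell_binom \<tau> \<eta> n m = ell_fact \<tau> \<eta> n / (ell_fact \<tau> \<eta> m * ell_fact \<tau> \<eta> (n - m))"

section \<open>The polynomials \<open>A\<^sub>j(E)\<close>\<close>

text \<open>
  Rows and columns of \<open>mat s s\<close> are numbered from 0, so the formula for the entries, stated for
  \<open>1 \<le> i, j \<le> s\<close>, is evaluated at \<open>(Suc i, Suc j)\<close>.
\<close>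

definition lame_entry :: "complex \<Rightarrow> complex \<Rightarrow> nat \<Rightarrow> complex \<Rightarrow> nat \<Rightarrow> nat \<Rightarrow> complex" where
  "lame_entry \<tau> \<eta> l E i j =
     (if i = j then E else 0)
     + (if j = i + 1 then ell_num \<tau> \<eta> (- int i) / ell_num \<tau> \<eta> (int l + 1 - int i) else 0)
     + (if i = j + 1 then ell_num \<tau> \<eta> (2 * int l + 2 - int i) / ell_num \<tau> \<eta> (int l + 1 - int i) else 0)"

definition lame_det :: "complex \<Rightarrow> complex \<Rightarrow> nat \<Rightarrow> nat \<Rightarrow> complex \<Rightarrow> complex" where
  "lame_det \<tau> \<eta> l s E = det (mat s s (\<lambda>(i, j). lame_entry \<tau> \<eta> l E (Suc i) (Suc j)))"

text \<open>
  \<open>lame_A \<tau> \<eta> l j\<close> is meaningful for \<open>j \<le> l\<close>; it has degree \<open>s = l - j\<close> in \<open>E\<close>.  For \<open>j = l\<close> the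
  determinant is that of an empty matrix, which gives the value 1.
\<close>

definition lame_A :: "complex \<Rightarrow> complex \<Rightarrow> nat \<Rightarrow> nat \<Rightarrow> complex \<Rightarrow> complex" where
  "lame_A \<tau> \<eta> l j E =
     ell_binom \<tau> \<eta> l (l - j) * inverse (ell_binom \<tau> \<eta> (2 * l) (l - j)) * lame_det \<tau> \<eta> l (l - j) E"

section \<open>The spectral curve\<close>

definition lame_N :: "nat \<Rightarrow> complex" where
  "lame_N l = of_nat l * (of_nat l + 1) / 2"

text \<open>Points are triples \<open>(\<zeta>, K, E)\<close>.\<close>

definition lame_cover :: "complex \<Rightarrow> complex \<Rightarrow> nat \<Rightarrow> (complex \<times> complex \<times> complex) set" where
  "lame_cover \<tau> \<eta> l = {(\<zeta>, K, E). K \<noteq> 0 \<and>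
     (\<Sum>j=0..l. (-1) ^ j * K powi (- int j) * theta1 \<tau> (\<zeta> - of_nat j * \<eta>)
        * ell_binom \<tau> \<eta> l j * lame_A \<tau> \<eta> l j E) = 0 \<and>
     (\<Sum>j=0..l+1. (-1) ^ j * K powi (- int j) * theta1 \<tau> (\<zeta> - of_nat j * \<eta>)
        * ell_num \<tau> \<eta> (int j - 1) * ell_binom \<tau> \<eta> (l + 1) j
        * lame_A \<tau> \<eta> l (nat \<bar>int j - 1\<bar>) E) = 0}"

text \<open>
  The orbit relation of the (commutative) group generated by
  \<open>(\<zeta>, K, E) \<mapsto> (\<zeta> + 1, K, E)\<close> and \<open>(\<zeta>, K, E) \<mapsto> (\<zeta> + \<tau>, K exp(2\<pi>\<i>\<eta>), E)\<close>.
\<close>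

definition lame_shift ::
  "complex \<Rightarrow> complex \<Rightarrow> int \<Rightarrow> int \<Rightarrow> complex \<times> complex \<times> complex \<Rightarrow> complex \<times> complex \<times> complex" where
  "lame_shift \<tau> \<eta> m n =
     (\<lambda>(\<zeta>, K, E). (\<zeta> + of_int m + of_int n * \<tau>, K * exp (2 * of_real pi * \<i> * \<eta>) powi n, E))"

definition lame_rel ::
  "complex \<Rightarrow> complex \<Rightarrow> nat \<Rightarrow> ((complex \<times> complex \<times> complex) \<times> (complex \<times> complex \<times> complex)) set" where
  "lame_rel \<tau> \<eta> l =
     {(p, q). p \<in> lame_cover \<tau> \<eta> l \<and> q \<in> lame_cover \<tau> \<eta> l \<and> (\<exists>m n. q = lame_shift \<tau> \<eta> m n p)}"

lemma lame_shift_0: "lame_shift \<tau> \<eta> 0 0 p = p"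
  by (cases p) (simp add: lame_shift_def)

lemma lame_shift_add:
  "lame_shift \<tau> \<eta> m n (lame_shift \<tau> \<eta> m' n' p) = lame_shift \<tau> \<eta> (m + m') (n + n') p"
  by (cases p) (simp add: lame_shift_def algebra_simps power_int_add)

lemma equiv_lame_rel: "equiv (lame_cover \<tau> \<eta> l) (lame_rel \<tau> \<eta> l)"
proof (rule equivI)
  show "lame_rel \<tau> \<eta> l \<subseteq> lame_cover \<tau> \<eta> l \<times> lame_cover \<tau> \<eta> l"
    by (auto simp: lame_rel_def)
  show "refl_on (lame_cover \<tau> \<eta> l) (lame_rel \<tau> \<eta> l)"
    unfolding refl_on_def lame_rel_def by (auto intro: lame_shift_0[symmetric])
  show "sym (lame_rel \<tau> \<eta> l)"
  proof (rule symI)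
    fix p q assume "(p, q) \<in> lame_rel \<tau> \<eta> l"
    then obtain m n where pq: "p \<in> lame_cover \<tau> \<eta> l" "q \<in> lame_cover \<tau> \<eta> l"
      and q: "q = lame_shift \<tau> \<eta> m n p" by (auto simp: lame_rel_def)
    have "p = lame_shift \<tau> \<eta> (- m) (- n) q"
      by (simp add: q lame_shift_add lame_shift_0)
    with pq show "(q, p) \<in> lame_rel \<tau> \<eta> l" by (auto simp: lame_rel_def)
  qed
  show "trans (lame_rel \<tau> \<eta> l)"
    by (rule transI) (auto simp: lame_rel_def lame_shift_add, blast)
qed

definition lame_curve :: "complex \<Rightarrow> complex \<Rightarrow> nat \<Rightarrow> (complex \<times> complex \<times> complex) set set" where
  "lame_curve \<tau> \<eta> l = lame_cover \<tau> \<eta> l // lame_rel \<tau> \<eta> l"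

definition lame_invol ::
  "complex \<Rightarrow> nat \<Rightarrow> complex \<times> complex \<times> complex \<Rightarrow> complex \<times> complex \<times> complex" where
  "lame_invol \<eta> l = (\<lambda>(\<zeta>, K, E). (2 * lame_N l * \<eta> - \<zeta>, inverse K, E))"

text \<open>The value of the function \<open>E\<close> at a point of the curve; it is constant on each class.\<close>

definition curve_E :: "(complex \<times> complex \<times> complex) set \<Rightarrow> complex" where
  "curve_E P = the_elem ((\<lambda>(\<zeta>, K, E). E) ` P)"

lemma curve_E_class:
  assumes "(\<zeta>, K, E) \<in> lame_cover \<tau> \<eta> l"
  shows "curve_E (lame_rel \<tau> \<eta> l `` {(\<zeta>, K, E)}) = E"
proof -
  have "(\<zeta>, K, E) \<in> lame_rel \<tau> \<eta> l `` {(\<zeta>, K, E)}"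
    using equiv_class_self[OF equiv_lame_rel assms] .
  then have "(\<lambda>(\<zeta>, K, E). E) ` (lame_rel \<tau> \<eta> l `` {(\<zeta>, K, E)}) = {E}"
    by (force simp: lame_rel_def lame_shift_def)
  then show ?thesis by (simp add: curve_E_def)
qed

text \<open>
  The involution acts on classes by taking images.  The two points at infinity that complete the
  curve are exchanged by it, so the fixed points all lie on the affine part \<open>lame_curve\<close>.
\<close>

definition lame_band_edges :: "complex \<Rightarrow> complex \<Rightarrow> nat \<Rightarrow> complex set" where
  "lame_band_edges \<tau> \<eta> l = curve_E ` {P \<in> lame_curve \<tau> \<eta> l. lame_invol \<eta> l ` P = P}"

section \<open>Common roots of the two polynomial equations\<close>

definition lame_common_roots :: "complex \<Rightarrow> complex \<Rightarrow> nat \<Rightarrow> nat \<Rightarrow> complex set" where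
  "lame_common_roots \<tau> \<eta> l a = {E.
     (\<Sum>j=0..l. (-1) ^ j * theta a \<tau> ((lame_N l - of_nat j) * \<eta>)
        * ell_binom \<tau> \<eta> l j * lame_A \<tau> \<eta> l j E) = 0 \<and>
     (\<Sum>j=0..l+1. (-1) ^ j * theta a \<tau> ((lame_N l - of_nat j) * \<eta>)
        * ell_num \<tau> \<eta> (int j - 1) * ell_binom \<tau> \<eta> (l + 1) j
        * lame_A \<tau> \<eta> l (nat \<bar>int j - 1\<bar>) E) = 0}"

end

theory Submission
  imports Defs
begin

text \<open>
  A fixed point of the involution satisfies \<open>2\<zeta> \<in> 2N\<eta> + \<int> + \<tau>\<int>\<close>, so up to the translations
  \<open>\<zeta> = N\<eta> + \<omega>\<close> with \<open>\<omega>\<close> one of the four half-periods, and then \<open>K\<^sup>2\<close> is 1 or \<open>exp(2\<pi>\<i>\<eta>)\<close>.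
  Shifting the argument of \<open>\<theta>\<^sub>1\<close> by a half-period turns it into one of the \<open>\<theta>\<^sub>a\<close>, up to an
  exponential factor whose dependence on \<open>j\<close> cancels against \<open>K\<^sup>-\<^sup>j\<close> for one choice of the sign
  of \<open>K\<close>.  The other sign of \<open>K\<close> is absorbed by \<open>E \<mapsto> -E\<close>, because \<open>A\<^sub>j\<close> has the parity
  of \<open>l - j\<close>.
\<close>

section \<open>Shifts of the theta functions\<close>

lemma exp_powi: "exp (z::complex) powi n = exp (of_int n * z)"
  by (simp add: exp_power_int mult.commute)

lemma exp_add_int_2pi: "exp (z + 2 * of_int k * of_real pi * \<i>) = exp z"
  using exp_powi[of "2 * of_real pi * \<i>" k] by (simp add: exp_add mult_ac)

text \<open>Completing the square, (k + 1/2)^2 + 2n(k + 1/2) = (k + n + 1/2)^2 - n^2, turns the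
  \<tau>-shift into a reindexing of the series.\<close>

lemma theta1_lattice_shift:
  "theta1 \<tau> (x + of_int m + of_int n * \<tau>) =
     exp (- (of_real pi * \<i> * \<tau> * of_int n ^ 2) - 2 * of_real pi * \<i> * of_int n * (x + 1/2)
          + of_real pi * \<i> * of_int m) * theta1 \<tau> x"
proof -
  define c where "c = exp (- (of_real pi * \<i> * \<tau> * of_int n ^ 2)
    - 2 * of_real pi * \<i> * of_int n * (x + 1/2) + of_real pi * \<i> * of_int m)"
  define f where "f = (\<lambda>k::int. exp (of_real pi * \<i> * \<tau> * (of_int k + 1/2)^2
                       + 2 * of_real pi * \<i> * (x + 1/2) * (of_int k + 1/2)))"
  have bij: "bij (\<lambda>k::int. k + n)"
    by (rule bij_betw_byWitness[where f' = "\<lambda>k. k - n"]) auto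
  have "exp (of_real pi * \<i> * \<tau> * (of_int k + 1/2)^2
          + 2 * of_real pi * \<i> * (x + of_int m + of_int n * \<tau> + 1/2) * (of_int k + 1/2))
        = c * f (k + n)" (is "exp ?a = _") for k
  proof -
    \<comment> \<open>The shift by \<open>m\<close> contributes 2 pi i m (k + 1/2); its half-integer
      part goes into \<open>c\<close>, and the last summand is the remaining multiple of 2 pi
      i.\<close>
    have a: "?a = (- (of_real pi * \<i> * \<tau> * of_int n ^ 2)
            - 2 * of_real pi * \<i> * of_int n * (x + 1/2) + of_real pi * \<i> * of_int m)
          + (of_real pi * \<i> * \<tau> * (of_int (k + n) + 1/2)^2
            + 2 * of_real pi * \<i> * (x + 1/2) * (of_int (k + n) + 1/2))
          + 2 * of_int (m * k) * of_real pi * \<i>"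
      by (simp add: field_simps power2_eq_square)
    show ?thesis
      unfolding a exp_add_int_2pi c_def f_def by (rule exp_add)
  qed
  then have "theta1 \<tau> (x + of_int m + of_int n * \<tau>) = - (\<Sum>\<^sub>\<infinity>k. c * f (k + n))"
    unfolding theta1_def by presburger
  also have "\<dots> = c * - (\<Sum>\<^sub>\<infinity>k. f (k + n))"
    by (simp add: infsum_cmult_right')
  also have "(\<Sum>\<^sub>\<infinity>k. f (k + n)) = (\<Sum>\<^sub>\<infinity>k. f k)"
    using infsum_reindex_bij_betw[OF bij, of f] .
  finally show ?thesis
    by (simp add: c_def f_def theta1_def)
qed

text \<open>The argument x + 1 yields the factor exp(2 pi i (k + 1/2)) = -1, which cancels the minus
  sign in front of the series for \<open>theta1\<close>.\<close>

lemma theta1_add_half: "theta1 \<tau> (x + 1/2) = theta2 \<tau> x"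
proof -
  have "exp (of_real pi * \<i> * \<tau> * (of_int k + 1/2)^2
          + 2 * of_real pi * \<i> * (x + 1/2 + 1/2) * (of_int k + 1/2))
      = - exp (of_real pi * \<i> * \<tau> * (of_int k + 1/2)^2
          + 2 * of_real pi * \<i> * x * (of_int k + 1/2))" (is "exp ?a = - exp ?b") for k :: int
  proof -
    have a: "?a = ?b + of_real pi * \<i> + 2 * of_int k * of_real pi * \<i>"
      by (simp add: field_simps)
    show ?thesis
      unfolding a exp_add_int_2pi by (simp add: exp_add)
  qed
  then show ?thesis
    by (simp add: theta1_def theta2_def infsum_uminus)
qed

lemma bij_int_Suc: "bij (\<lambda>k::int. k + 1)"
  by (rule bij_betw_byWitness[where f' = "\<lambda>k. k - 1"]) auto

text \<open>Here (k + 1/2)^2 + (k + 1/2) = (k + 1)^2 - 1/4, so the half-integer exponents become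
  integers and the summation index moves by one.\<close>

lemma theta2_add_half_period:
  "theta2 \<tau> (x + \<tau>/2) = exp (- (of_real pi * \<i> * \<tau> / 4) - of_real pi * \<i> * x) * theta3 \<tau> x"
proof -
  define f where "f = (\<lambda>k::int. exp (of_real pi * \<i> * \<tau> * of_int k ^ 2
                       + 2 * of_real pi * \<i> * x * of_int k))"
  define c where "c = exp (- (of_real pi * \<i> * \<tau> / 4) - of_real pi * \<i> * x)"
  have "exp (of_real pi * \<i> * \<tau> * (of_int k + 1/2)^2
          + 2 * of_real pi * \<i> * (x + \<tau>/2) * (of_int k + 1/2)) = c * f (k + 1)" for k
    unfolding c_def f_def exp_add[symmetric]
    by (rule arg_cong[where f = exp]) (simp add: field_simps power2_eq_square)
  then have "theta2 \<tau> (x + \<tau>/2) = c * (\<Sum>\<^sub>\<infinity>k. f (k + 1))"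
    unfolding theta2_def by (simp add: infsum_cmult_right')
  also have "(\<Sum>\<^sub>\<infinity>k. f (k + 1)) = theta3 \<tau> x"
    using infsum_reindex_bij_betw[OF bij_int_Suc, of f] by (simp add: f_def theta3_def)
  finally show ?thesis by (simp add: c_def)
qed

lemma theta1_add_half_period:
  "theta1 \<tau> (x + \<tau>/2) =
     - exp (- (of_real pi * \<i> * \<tau> / 4) - of_real pi * \<i> * (x + 1/2)) * theta4 \<tau> x"
proof -
  have "theta1 \<tau> y = - theta2 \<tau> (y + 1/2)" for y
    by (simp add: theta1_def theta2_def)
  moreover have "theta3 \<tau> (x + 1/2) = theta4 \<tau> x"
    by (simp add: theta3_def theta4_def)
  ultimately show ?thesis
    using theta2_add_half_period[of \<tau> "x + 1/2"] by (simp add: algebra_simps)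
qed

section \<open>The pair of equations for general weights\<close>

text \<open>The weights \<open>T\<close> stand for the theta values together with any powers of K,
  so that the curve equations and the common-root equations are instances of one system.\<close>

definition lame_system :: "complex \<Rightarrow> complex \<Rightarrow> nat \<Rightarrow> (nat \<Rightarrow> complex) \<Rightarrow> complex \<Rightarrow> bool" where
  "lame_system \<tau> \<eta> l T E \<longleftrightarrow>
     (\<Sum>j=0..l. (-1) ^ j * T j * ell_binom \<tau> \<eta> l j * lame_A \<tau> \<eta> l j E) = 0 \<and>
     (\<Sum>j=0..l+1. (-1) ^ j * T j * ell_num \<tau> \<eta> (int j - 1) * ell_binom \<tau> \<eta> (l + 1) j
        * lame_A \<tau> \<eta> l (nat \<bar>int j - 1\<bar>) E) = 0"

lemma mem_lame_cover_iff:
  "(\<zeta>, K, E) \<in> lame_cover \<tau> \<eta> l \<longleftrightarrow>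
     K \<noteq> 0 \<and> lame_system \<tau> \<eta> l (\<lambda>j. K powi (- int j) * theta1 \<tau> (\<zeta> - of_nat j * \<eta>)) E"
  by (simp add: lame_cover_def lame_system_def mult.assoc)

lemma mem_lame_common_roots_iff:
  "E \<in> lame_common_roots \<tau> \<eta> l a \<longleftrightarrow>
     lame_system \<tau> \<eta> l (\<lambda>j. theta a \<tau> ((lame_N l - of_nat j) * \<eta>)) E"
  by (simp add: lame_common_roots_def lame_system_def)

text \<open>Both equations are linear and homogeneous in the weights, so quasi-periodicity factors
  matter only through their dependence on \<open>j\<close>.\<close>

lemma lame_system_proportional:
  assumes "c \<noteq> 0" "\<And>j. T' j = c * T j"
  shows "lame_system \<tau> \<eta> l T' E \<longleftrightarrow> lame_system \<tau> \<eta> l T E"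
proof -
  have "(\<Sum>j=0..l. (-1) ^ j * T' j * ell_binom \<tau> \<eta> l j * lame_A \<tau> \<eta> l j E)
      = c * (\<Sum>j=0..l. (-1) ^ j * T j * ell_binom \<tau> \<eta> l j * lame_A \<tau> \<eta> l j E)"
    by (simp only: assms sum_distrib_left mult_ac)
  moreover have "(\<Sum>j=0..l+1. (-1) ^ j * T' j * ell_num \<tau> \<eta> (int j - 1)
        * ell_binom \<tau> \<eta> (l + 1) j * lame_A \<tau> \<eta> l (nat \<bar>int j - 1\<bar>) E)
      = c * (\<Sum>j=0..l+1. (-1) ^ j * T j * ell_num \<tau> \<eta> (int j - 1)
        * ell_binom \<tau> \<eta> (l + 1) j * lame_A \<tau> \<eta> l (nat \<bar>int j - 1\<bar>) E)"
    by (simp only: assms sum_distrib_left mult_ac)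
  ultimately show ?thesis
    using assms(1) by (simp only: lame_system_def mult_eq_0_iff simp_thms)
qed

text \<open>Only diagonal entries contain E, and the off-diagonal ones join indices of opposite
  parity. Negating E therefore amounts to conjugating by the diagonal matrix of signs (-1)^i and
  negating the whole matrix; the proof carries this out on the Leibniz expansion.\<close>

lemma lame_det_minus: "lame_det \<tau> \<eta> l s (- E) = (-1) ^ s * lame_det \<tau> \<eta> l s E"
proof -
  have entry: "lame_entry \<tau> \<eta> l (- E) (Suc i) (Suc j)
      = - ((-1) ^ i * (-1) ^ j * lame_entry \<tau> \<eta> l E (Suc i) (Suc j))" for i j
    by (auto simp: lame_entry_def simp flip: power_add)
  have "(\<Prod>i = 0..<s. lame_entry \<tau> \<eta> l (- E) (Suc i) (Suc (p i)))
      = (-1) ^ s * (\<Prod>i = 0..<s. lame_entry \<tau> \<eta> l E (Suc i) (Suc (p i)))"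
    if p: "p permutes {0..<s}" for p
  proof -
    \<comment> \<open>A permutation only reorders the column signs, so their product equals that of
      the row signs and the two cancel.\<close>
    have "(\<Prod>i = 0..<s. (-1::complex) ^ p i) = (\<Prod>i = 0..<s. (-1) ^ i)"
      using prod.permute[OF p, of "\<lambda>i. (-1::complex) ^ i"] by (simp add: o_def)
    moreover have "(\<Prod>i = 0..<s. (-1::complex) ^ i) * (\<Prod>i = 0..<s. (-1) ^ i) = 1"
      by (simp flip: prod.distrib power_mult_distrib)
    ultimately show ?thesis
      by (simp add: entry prod.distrib prod_uminus mult.assoc[symmetric])
  qed
  moreover have "det (mat s s (\<lambda>(i, j). lame_entry \<tau> \<eta> l F (Suc i) (Suc j)))
      = (\<Sum>p | p permutes {0..<s}. signof p * (\<Prod>i = 0..<s. lame_entry \<tau> \<eta> l F (Suc i) (Suc (p i))))"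
    for F
    by (simp add: det_def)
  ultimately show ?thesis
    unfolding lame_det_def by (simp add: sum_distrib_left mult_ac)
qed

lemma lame_A_minus: "lame_A \<tau> \<eta> l j (- E) = (-1) ^ (l - j) * lame_A \<tau> \<eta> l j E"
  by (simp add: lame_A_def lame_det_minus)

text \<open>The parity of \<open>lame_A\<close> combines with the weight sign (-1)^j into a sign
  independent of \<open>j\<close>: (-1)^l in the first equation, (-1)^(l+1) in the second.\<close>

lemma lame_system_minus:
  assumes "l \<ge> 1"
  shows "lame_system \<tau> \<eta> l (\<lambda>j. (-1) ^ j * T j) (- E) \<longleftrightarrow> lame_system \<tau> \<eta> l T E"
proof -
  have sign1: "(-1::complex) ^ j * (-1) ^ (l - j) = (-1) ^ l" if "j \<le> l" for j
    using that by (simp flip: power_add)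
  have sign2: "(-1::complex) ^ j * (-1) ^ (l - nat \<bar>int j - 1\<bar>) = (-1) ^ (l + 1)" if "j \<le> l + 1" for j
  proof (cases j)
    case 0
    \<comment> \<open>For j = 0 the index |j - 1| is 1; l >= 1 makes the natural subtraction l - 1 a
      true one.\<close>
    have "(-1::complex) ^ (l + 1) = (-1) ^ (l - 1) * (-1) ^ 2"
      using power_add[of "-1::complex" "l - 1" 2] assms by simp
    with 0 show ?thesis by simp
  next
    case (Suc i)
    with that sign1[of i] show ?thesis by simp
  qed
  have "(\<Sum>j=0..l. (-1) ^ j * ((-1) ^ j * T j) * ell_binom \<tau> \<eta> l j * lame_A \<tau> \<eta> l j (- E))
      = (\<Sum>j=0..l. (-1) ^ l * ((-1) ^ j * T j * ell_binom \<tau> \<eta> l j * lame_A \<tau> \<eta> l j E))"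
    by (intro sum.cong refl, subst sign1[symmetric]) (auto simp: lame_A_minus)
  moreover have "(\<Sum>j=0..l+1. (-1) ^ j * ((-1) ^ j * T j) * ell_num \<tau> \<eta> (int j - 1)
        * ell_binom \<tau> \<eta> (l + 1) j * lame_A \<tau> \<eta> l (nat \<bar>int j - 1\<bar>) (- E))
      = (\<Sum>j=0..l+1. (-1) ^ (l + 1) * ((-1) ^ j * T j * ell_num \<tau> \<eta> (int j - 1)
        * ell_binom \<tau> \<eta> (l + 1) j * lame_A \<tau> \<eta> l (nat \<bar>int j - 1\<bar>) E))"
    by (intro sum.cong refl, subst sign2[symmetric]) (auto simp: lame_A_minus)
  ultimately show ?thesis
    by (simp only: lame_system_def sum_distrib_left[symmetric]) simp
qed

text \<open>Negating K multiplies the weight K^(-j) by (-1)^j. This symmetry is the source of the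
  reflection of the band edges.\<close>

lemma lame_cover_minus:
  assumes "l \<ge> 1"
  shows "(\<zeta>, - K, - E) \<in> lame_cover \<tau> \<eta> l \<longleftrightarrow> (\<zeta>, K, E) \<in> lame_cover \<tau> \<eta> l"
proof -
  have "(- K) powi (- int j) = (-1) ^ j * K powi (- int j)" for j
    using power_int_mult_distrib[of "-1" K "- int j"] by (simp add: power_int_minus flip: power_inverse)
  then show ?thesis
    using lame_system_minus[OF assms, of \<tau> \<eta> "\<lambda>j. K powi (- int j) * theta1 \<tau> (\<zeta> - of_nat j * \<eta>)" E]
    by (simp add: mem_lame_cover_iff mult.assoc)
qed

section \<open>Classes fixed by the involution\<close>

text \<open>The multiplier of \<open>theta1\<close> at \<zeta> - j\<eta> depends on \<open>j\<close>
  through q^(nj), which the factor q^(-nj) from the new K removes; the weights then change by a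
  common constant.\<close>

lemma lame_shift_mem_cover:
  assumes "p \<in> lame_cover \<tau> \<eta> l"
  shows "lame_shift \<tau> \<eta> m n p \<in> lame_cover \<tau> \<eta> l"
proof -
  obtain \<zeta> K E where p: "p = (\<zeta>, K, E)" by (cases p)
  define q where "q = exp (2 * of_real pi * \<i> * \<eta>)"
  define c where "c = exp (- (of_real pi * \<i> * \<tau> * of_int n ^ 2)
    - 2 * of_real pi * \<i> * of_int n * (\<zeta> + 1/2) + of_real pi * \<i> * of_int m)"
  have "(K * q powi n) powi (- int j) * theta1 \<tau> (\<zeta> + of_int m + of_int n * \<tau> - of_nat j * \<eta>)
      = c * (K powi (- int j) * theta1 \<tau> (\<zeta> - of_nat j * \<eta>))" for j
  proof -
    define d where "d = exp (- (of_real pi * \<i> * \<tau> * of_int n ^ 2)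
      - 2 * of_real pi * \<i> * of_int n * (\<zeta> - of_nat j * \<eta> + 1/2) + of_real pi * \<i> * of_int m)"
    have "(q powi n) powi (- int j) * d = c"
      unfolding q_def c_def d_def exp_powi exp_add[symmetric]
      by (rule arg_cong[where f = exp]) (simp add: algebra_simps)
    moreover have "theta1 \<tau> (\<zeta> + of_int m + of_int n * \<tau> - of_nat j * \<eta>)
        = d * theta1 \<tau> (\<zeta> - of_nat j * \<eta>)"
      using theta1_lattice_shift[of \<tau> "\<zeta> - of_nat j * \<eta>" m n] by (simp add: d_def algebra_simps)
    ultimately show ?thesis by (simp add: power_int_mult_distrib mult_ac)
  qed
  then show ?thesis
    using assms lame_system_proportional[of c]
    by (simp add: p lame_shift_def mem_lame_cover_iff q_def c_def)
qed

lemma lame_class_eq: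
  assumes "p \<in> lame_cover \<tau> \<eta> l"
  shows "lame_rel \<tau> \<eta> l `` {p} = {lame_shift \<tau> \<eta> m n p | m n. True}"
  using assms by (auto simp: lame_rel_def lame_shift_mem_cover)

lemma lame_invol_shift:
  "lame_invol \<eta> l (lame_shift \<tau> \<eta> m n p) = lame_shift \<tau> \<eta> (- m) (- n) (lame_invol \<eta> l p)"
  by (cases p) (simp add: lame_invol_def lame_shift_def power_int_minus)

text \<open>The involution reverses shifts, hence maps the orbit of \<open>p\<close> onto the orbit
  of its image; one point of the orbit decides.\<close>

lemma lame_class_fixed_iff:
  assumes p: "p \<in> lame_cover \<tau> \<eta> l"
  shows "lame_invol \<eta> l ` (lame_rel \<tau> \<eta> l `` {p}) = lame_rel \<tau> \<eta> l `` {p} \<longleftrightarrow>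
    (\<exists>m n. lame_invol \<eta> l p = lame_shift \<tau> \<eta> m n p)" (is "?L \<longleftrightarrow> ?R")
proof
  assume ?L
  moreover have "p \<in> lame_rel \<tau> \<eta> l `` {p}"
    using equiv_class_self[OF equiv_lame_rel p] .
  ultimately have "lame_invol \<eta> l p \<in> lame_rel \<tau> \<eta> l `` {p}" by blast
  then show ?R by (auto simp: lame_class_eq[OF p])
next
  assume ?R
  then obtain a b where ab: "lame_invol \<eta> l p = lame_shift \<tau> \<eta> a b p" by blast
  have invol: "lame_invol \<eta> l (lame_shift \<tau> \<eta> m n p) = lame_shift \<tau> \<eta> (a - m) (b - n) p" for m n
    by (simp add: lame_invol_shift ab lame_shift_add)
  show ?L
    unfolding lame_class_eq[OF p]
  proof (intro equalityI subsetI)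
    fix x assume "x \<in> {lame_shift \<tau> \<eta> m n p | m n. True}"
    then obtain m n where "x = lame_shift \<tau> \<eta> m n p" by blast
    \<comment> \<open>On the orbit the involution acts by (m, n) to (a - m, b - n), which is its own
      inverse and so supplies the preimage.\<close>
    then have "x = lame_invol \<eta> l (lame_shift \<tau> \<eta> (a - m) (b - n) p)"
      by (simp add: invol)
    then show "x \<in> lame_invol \<eta> l ` {lame_shift \<tau> \<eta> m n p | m n. True}" by blast
    next
    fix x assume "x \<in> lame_invol \<eta> l ` {lame_shift \<tau> \<eta> m n p | m n. True}"
    then obtain m n where "x = lame_invol \<eta> l (lame_shift \<tau> \<eta> m n p)" by blast
    then have "x = lame_shift \<tau> \<eta> (a - m) (b - n) p"
      by (simp only: invol)
    then show "x \<in> {lame_shift \<tau> \<eta> m n p | m n. True}" by blast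
  qed
qed

text \<open>Removes the quotient: from here on, fixed classes are handled through
  representatives.\<close>

lemma mem_lame_band_edges_iff:
  "E \<in> lame_band_edges \<tau> \<eta> l \<longleftrightarrow>
     (\<exists>\<zeta> K m n. (\<zeta>, K, E) \<in> lame_cover \<tau> \<eta> l \<and>
        lame_invol \<eta> l (\<zeta>, K, E) = lame_shift \<tau> \<eta> m n (\<zeta>, K, E))" (is "?L \<longleftrightarrow> ?R")
proof
  assume ?L
  then obtain p where p: "p \<in> lame_cover \<tau> \<eta> l" "E = curve_E (lame_rel \<tau> \<eta> l `` {p})"
      "lame_invol \<eta> l ` (lame_rel \<tau> \<eta> l `` {p}) = lame_rel \<tau> \<eta> l `` {p}"
    by (auto simp: lame_band_edges_def lame_curve_def quotient_def)
  obtain \<zeta> K F where "p = (\<zeta>, K, F)" by (cases p)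
  with p show ?R
    using curve_E_class[of \<zeta> K F \<tau> \<eta> l] lame_class_fixed_iff[OF p(1)] by auto
next
  assume ?R
  then obtain \<zeta> K m n where p: "(\<zeta>, K, E) \<in> lame_cover \<tau> \<eta> l"
    and fp: "lame_invol \<eta> l (\<zeta>, K, E) = lame_shift \<tau> \<eta> m n (\<zeta>, K, E)" by blast
  let ?P = "lame_rel \<tau> \<eta> l `` {(\<zeta>, K, E)}"
  have "?P \<in> lame_curve \<tau> \<eta> l"
    unfolding lame_curve_def using p by (rule quotientI)
  moreover have "lame_invol \<eta> l ` ?P = ?P"
    using lame_class_fixed_iff[OF p] fp by blast
  ultimately show ?L
    unfolding lame_band_edges_def using curve_E_class[OF p] by (auto intro!: image_eqI[of _ _ ?P])
qed

section \<open>Half-periods\<close>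

text \<open>The index \<open>a\<close> of the theta function obtained from \<open>theta1\<close> by
  the half-period (r + s\<tau>)/2.\<close>

definition half_period_index :: "int \<Rightarrow> int \<Rightarrow> nat" where
  "half_period_index r s = (if s = 0 then (if r = 0 then 1 else 2) else (if r = 0 then 4 else 3))"

text \<open>The exponential in \<open>x\<close> is kept apart from \<open>c\<close> because, at x =
  (N - j)\<eta>, it carries all the \<open>j\<close>-dependence of the factor.\<close>

lemma theta1_half_period_shift:
  assumes "r \<in> {0, 1}" "s \<in> {0, 1}"
  obtains c where "c \<noteq> 0"
    "\<And>x. theta1 \<tau> (x + of_int r / 2 + of_int s * \<tau> / 2)
        = c * exp (- (of_int s * of_real pi * \<i> * x)) * theta (half_period_index r s) \<tau> x"
proof -
  define e where "e = exp (- (of_real pi * \<i> * \<tau> / 4))"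
  define h where "h = exp (- (of_real pi * \<i> / 2))"
  consider "r = 0" "s = 0" | "r = 1" "s = 0" | "r = 0" "s = 1" | "r = 1" "s = 1"
    using assms by auto
  then show ?thesis
  proof cases
    case 1
    then show ?thesis
      by (intro that[of 1]) (auto simp: half_period_index_def theta_def)
  next
    case 2
    then show ?thesis
      by (intro that[of 1]) (auto simp: half_period_index_def theta_def theta1_add_half)
  next
    case 3
    have "theta1 \<tau> (x + \<tau>/2) = - (e * h) * exp (- (of_real pi * \<i> * x)) * theta4 \<tau> x" for x
      unfolding theta1_add_half_period e_def h_def
      by (simp add: exp_add[symmetric] exp_diff exp_minus field_simps)
    with 3 show ?thesis
      by (intro that[of "- (e * h)"]) (auto simp: half_period_index_def theta_def e_def h_def)
  next
    case 4
    have "theta1 \<tau> (x + 1/2 + \<tau>/2) = e * exp (- (of_real pi * \<i> * x)) * theta3 \<tau> x" for x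
    proof -
      have "theta1 \<tau> (x + 1/2 + \<tau>/2) = theta2 \<tau> (x + \<tau>/2)"
        using theta1_add_half[of \<tau> "x + \<tau>/2"] by (simp add: add_ac)
      then show ?thesis
        by (simp add: theta2_add_half_period e_def flip: exp_add)
    qed
    with 4 show ?thesis
      by (intro that[of e]) (auto simp: half_period_index_def theta_def e_def)
  qed
qed

text \<open>With K = exp(s pi i \<eta>), the power K^(-j) cancels the factor exp(s pi i j\<eta>)
  produced by the half-period shift at (N - j)\<eta>.\<close>

lemma half_period_mem_cover_iff:
  assumes "r \<in> {0, 1}" "s \<in> {0, 1}"
  shows "(lame_N l * \<eta> + of_int r / 2 + of_int s * \<tau> / 2, exp (of_int s * of_real pi * \<i> * \<eta>), E)
      \<in> lame_cover \<tau> \<eta> l \<longleftrightarrow> E \<in> lame_common_roots \<tau> \<eta> l (half_period_index r s)"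
proof -
  obtain c where c: "c \<noteq> 0" and shift:
    "\<And>x. theta1 \<tau> (x + of_int r / 2 + of_int s * \<tau> / 2)
        = c * exp (- (of_int s * of_real pi * \<i> * x)) * theta (half_period_index r s) \<tau> x"
    using theta1_half_period_shift[OF assms] by metis
  define d where "d = c * exp (- (of_int s * of_real pi * \<i> * (lame_N l * \<eta>)))"
  have "exp (of_int s * of_real pi * \<i> * \<eta>) powi (- int j)
        * theta1 \<tau> (lame_N l * \<eta> + of_int r / 2 + of_int s * \<tau> / 2 - of_nat j * \<eta>)
      = d * theta (half_period_index r s) \<tau> ((lame_N l - of_nat j) * \<eta>)" for j
  proof -
    have K: "exp (of_int s * of_real pi * \<i> * \<eta>) powi (- int j)
        * exp (- (of_int s * of_real pi * \<i> * ((lame_N l - of_nat j) * \<eta>)))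
        = exp (- (of_int s * of_real pi * \<i> * (lame_N l * \<eta>)))"
      unfolding exp_powi exp_add[symmetric]
      by (rule arg_cong[where f = exp]) (simp add: algebra_simps)
    have arg: "lame_N l * \<eta> + of_int r / 2 + of_int s * \<tau> / 2 - of_nat j * \<eta>
        = (lame_N l - of_nat j) * \<eta> + of_int r / 2 + of_int s * \<tau> / 2"
      by (simp add: algebra_simps)
    show ?thesis
      unfolding arg shift d_def K[symmetric] by (simp only: mult_ac)
  qed
  moreover have "d \<noteq> 0" using c by (simp add: d_def)
  ultimately show ?thesis
    using lame_system_proportional[of d]
    by (simp add: mem_lame_cover_iff mem_lame_common_roots_iff)
qed

theorem corollary4p1:
  fixes l :: nat and \<tau> \<eta> :: complex
  assumes "l \<ge> 1"
    and "Im \<tau> > 0"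
    and "\<And>m a b :: int. m \<noteq> 0 \<Longrightarrow> of_int m * \<eta> \<noteq> of_int a + of_int b * \<tau>"
  shows "lame_band_edges \<tau> \<eta> l =
           (\<Union>a\<in>{1..4}. lame_common_roots \<tau> \<eta> l a)
           \<union> uminus ` (\<Union>a\<in>{1..4}. lame_common_roots \<tau> \<eta> l a)"
    (is "_ = ?U \<union> uminus ` ?U")
proof (intro equalityI subsetI)
  fix E assume "E \<in> lame_band_edges \<tau> \<eta> l"
  then obtain \<zeta> K m n where p: "(\<zeta>, K, E) \<in> lame_cover \<tau> \<eta> l"
    and fp: "lame_invol \<eta> l (\<zeta>, K, E) = lame_shift \<tau> \<eta> m n (\<zeta>, K, E)"
    by (auto simp: mem_lame_band_edges_iff)
  define q where "q = exp (2 * of_real pi * \<i> * \<eta>)"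
  \<comment> \<open>Halves rounded up: translating \<zeta> = N\<eta> - m/2 - n\<tau>/2 by m' +
    n'\<tau> leaves a half-period with \<open>r\<close> and \<open>s\<close> in {0, 1}.\<close>
  define m' n' where "m' = (m + 1) div 2" and "n' = (n + 1) div 2"
  define r s where "r = 2 * m' - m" and "s = 2 * n' - n"
  have rs: "r \<in> {0, 1}" "s \<in> {0, 1}"
    by (auto simp: r_def s_def m'_def n'_def)
  define \<kappa> where "\<kappa> = exp (of_int s * of_real pi * \<i> * \<eta>)"
  define K' where "K' = K * q powi n'"
  have q0: "q \<noteq> 0" and K0: "K \<noteq> 0"
    using p by (auto simp: q_def mem_lame_cover_iff)
  have "2 * \<zeta> = 2 * lame_N l * \<eta> - of_int m - of_int n * \<tau>"
    using fp by (simp add: lame_invol_def lame_shift_def algebra_simps)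
  then have \<zeta>_eq: "\<zeta> = lame_N l * \<eta> - of_int m / 2 - of_int n * \<tau> / 2"
    by (metis (no_types, lifting) diff_divide_distrib mult.assoc nonzero_mult_div_cancel_left
        zero_neq_numeral)
  have \<zeta>: "\<zeta> + of_int m' + of_int n' * \<tau> = lame_N l * \<eta> + of_int r / 2 + of_int s * \<tau> / 2"
    unfolding \<zeta>_eq by (simp add: r_def s_def field_simps)
  have "inverse K = K * q powi n"
    using fp by (simp add: lame_invol_def lame_shift_def q_def)
  then have "K ^ 2 * q powi n = 1"
    using K0 by (simp add: power2_eq_square field_simps)
  then have "K ^ 2 = q powi (- n)"
    using q0 by (simp add: power_int_minus field_simps)
  \<comment> \<open>The exponent 2n' - n is \<open>s\<close>, which determines K' up to
    sign.\<close>
  then have "K' ^ 2 = q powi (- n) * (q powi n' * q powi n')"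
    by (simp add: K'_def power_mult_distrib power2_eq_square)
  also have "\<dots> = q powi s"
    using q0 by (simp add: s_def flip: power_int_add)
  also have "\<dots> = \<kappa> ^ 2"
    by (simp add: q_def \<kappa>_def exp_powi power2_eq_square mult_ac flip: exp_add)
  finally have K': "K' = \<kappa> \<or> K' = - \<kappa>"
    by (simp add: power2_eq_iff)
  have "(lame_N l * \<eta> + of_int r / 2 + of_int s * \<tau> / 2, K', E) \<in> lame_cover \<tau> \<eta> l"
    using lame_shift_mem_cover[OF p, of m' n'] \<zeta> by (simp add: lame_shift_def K'_def q_def)
  \<comment> \<open>For K' = -\<kappa>, the symmetry (K, E) to (-K, -E) returns to \<kappa> and
    makes -E the common root.\<close>
  then have "E \<in> lame_common_roots \<tau> \<eta> l (half_period_index r s) \<or>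
      - E \<in> lame_common_roots \<tau> \<eta> l (half_period_index r s)"
    using K' half_period_mem_cover_iff[OF rs, of l \<eta> \<tau>]
      lame_cover_minus[OF assms(1), of _ \<kappa> "- E" \<tau> \<eta>]
    by (auto simp: \<kappa>_def)
  moreover have "half_period_index r s \<in> {1..4}"
    by (simp add: half_period_index_def)
  ultimately have "E \<in> ?U \<or> - E \<in> ?U" by blast
  then show "E \<in> ?U \<union> uminus ` ?U"
    by (metis UnI1 UnI2 image_eqI minus_minus)
next
  fix E assume "E \<in> ?U \<union> uminus ` ?U"
  then obtain F a where F: "F \<in> lame_common_roots \<tau> \<eta> l a" "E = F \<or> E = - F" and a: "a \<in> {1..4}"
    by blast
  have "a \<in> {1, 2, 3, 4}" using a by auto
  then have "\<exists>r\<in>{0, 1}. \<exists>s\<in>{0, 1}. a = half_period_index r s"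
    by (auto simp: half_period_index_def)
  then obtain r s where rs: "r \<in> {0, 1}" "s \<in> {0, 1}" and a_eq: "a = half_period_index r s"
    by blast
  define \<zeta> \<kappa> where "\<zeta> = lame_N l * \<eta> + of_int r / 2 + of_int s * \<tau> / 2"
    and "\<kappa> = exp (of_int s * of_real pi * \<i> * \<eta>)"
  have "(\<zeta>, \<kappa>, F) \<in> lame_cover \<tau> \<eta> l"
    using F(1) half_period_mem_cover_iff[OF rs] by (simp add: \<zeta>_def \<kappa>_def a_eq)
  moreover from this have "(\<zeta>, - \<kappa>, - F) \<in> lame_cover \<tau> \<eta> l"
    by (simp add: lame_cover_minus[OF assms(1)])
  ultimately obtain K where K: "(\<zeta>, K, E) \<in> lame_cover \<tau> \<eta> l" "K = \<kappa> \<or> K = - \<kappa>"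
    using F(2) by blast
  \<comment> \<open>Since \<kappa>^2 = q^s and 2N\<eta> - \<zeta> = \<zeta> - r - s\<tau>, the
    involution acts here as the shift by (-r, -s), for either sign of K.\<close>
  have "inverse \<kappa> = \<kappa> * exp (2 * of_real pi * \<i> * \<eta>) powi (- s)"
    unfolding \<kappa>_def exp_powi exp_add[symmetric] exp_minus[symmetric]
    by (rule arg_cong[where f = exp]) (simp add: algebra_simps)
  then have "lame_invol \<eta> l (\<zeta>, K, E) = lame_shift \<tau> \<eta> (- r) (- s) (\<zeta>, K, E)"
    using K(2) by (auto simp: lame_invol_def lame_shift_def \<zeta>_def field_simps)
  with K(1) show "E \<in> lame_band_edges \<tau> \<eta> l"
    by (auto simp: mem_lame_band_edges_iff)
qed

end
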